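(* Let $F,G\in\mathcal{M}(r\times m;\mathcal{F})$ be such that the matrix pencil $sF-G$ is singular, let $P,Q$ be nonsingular matrices with $PFQ=F_K$, $PGQ=G_K$ (Kronecker canonical form), and let $Q_p$ be the block of the columns of $Q$ corresponding to the finite elementary divisors, with $J_p$ the corresponding Jordan matrix. Consider the system $$FY_{k+1}=GY_k,\qquad k\ge k_0,$$ with known (given) initial condition $Y_{k_0}\in\mathcal{M}(m\times 1;\mathcal{F})$. Then its solution is unique if and only if there are no column minimal indices, i.e. $$\dim\mathcal{N}_r(sF-G)=0,$$ and $$Y_{k_0}\in\operatorname{colspan}Q_p .$$ The unique solution is then given by the formula $$Y_k=Q_pJ_p^{\,k-k_0}Z^p_{k_0},$$ where $Z^p_{k_0}$ is the unique solution of the algebraic system $Y_{k_0}=Q_pZ^p_{k_0}$. In any other case the system has infinitely many solutions.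
   Context: $\mathcal{F}$ is a field and $\mathcal{M}(a\times b;\mathcal{F})$ is the set of $a\times b$ matrices over $\mathcal{F}$; $0_{a,b}$ is the $a\times b$ zero matrix. A solution is a sequence $(Y_k)_{k\ge k_0}$ of column vectors in $\mathcal{M}(m\times1;\mathcal{F})$ satisfying $FY_{k+1}=GY_k$ for all $k\ge k_0$ and having the prescribed value at $k=k_0$. The pencil $sF-G$ ($s$ an indeterminate) is regular if $r=m$ and $\det(sF-G)$ is not identically zero; otherwise it is singular. $\mathcal{N}_r(sF-G)$ and $\mathcal{N}_l(sF-G)$ are the right and left null spaces of $sF-G$ as vector spaces over the field of rational functions in $s$, of dimensions $d$ and $t$. The degrees of minimal polynomial bases of these spaces are the column minimal indices (c.m.i.) $\epsilon_1=\dots=\epsilon_g=0<\epsilon_{g+1}\le\dots\le\epsilon_d$ and the row minimal indices (r.m.i.) $\zeta_1=\dots=\zeta_h=0<\zeta_{h+1}\le\dots\le\zeta_t$. Kronecker canonical form: there are nonsingular $P$ ($r\times r$) and $Q$ ($m\times m$) with $PFQ=F_K$, $PGQ=G_K$, where $$sF_K-G_K=(sI_p-J_p)\oplus(sH_q-I_q)\oplus(sF_\epsilon-G_\epsilon)\oplus(sF_\zeta-G_\zeta)\oplus 0_{h,g}$$ ($\oplus$ is block-diagonal direct sum; any block may be absent). The existence of such $P,Q$ over $\mathcal{F}$ (i.e. with the finite eigenvalues in $\mathcal{F}$) is a standing assumption. Here: - $J_p$ is the $p\times p$ direct sum of upper Jordan blocks $J_{p_j}(a_j)$ (with $a_j$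 on the diagonal, $1$ on the superdiagonal), one for each finite elementary divisor $(s-a_j)^{p_j}$, $\sum_j p_j=p$. - $H_q$ is the $q\times q$ direct sum of nilpotent blocks $H_{q_j}$ (size $q_j$, ones on the superdiagonal, zeros elsewhere), one for each infinite elementary divisor $\hat s^{q_j}$, $\sum_j q_j=q$. - $F_\epsilon=\operatorname{blockdiag}\{L_{\epsilon_{g+1}},\dots,L_{\epsilon_d}\}$, $G_\epsilon=\operatorname{blockdiag}\{\bar L_{\epsilon_{g+1}},\dots,\bar L_{\epsilon_d}\}$, with $L_{\epsilon}=[\,I_{\epsilon}\ \ 0_{\epsilon,1}\,]$ and $\bar L_{\epsilon}=[\,0_{\epsilon,1}\ \ I_{\epsilon}\,]$. - $F_\zeta$, $G_\zeta$ are block diagonal with blocks $\begin{bmatrix} I_{\zeta_j} \\ 0_{1,\zeta_j} \end{bmatrix}$ and $\begin{bmatrix} 0_{1,\zeta_j} \\ I_{\zeta_j} \end{bmatrix}$ respectively, $j=h+1,\dots,t$. The columns of $Q$ are partitioned conformably with the column partition of $F_K$ as $Q=[\,Q_p\ Q_q\ Q_\epsilon\ Q_\zeta\ Q_g\,]$; in particular $Q_p$ is $m\times p$. $\operatorname{colspan}Q_p$ is the column space of $Q_p$.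
   Formalization: The last sentence is proved as: in any other case, if the system with the given initial condition has a solution at all, it has infinitely many; without this proviso it is false, e.g. F=(1,0)^T, G=(0,1)^T, Y_{k0}=1 has no solution. *)

theory Defs
  imports
    "Jordan_Normal_Form.Jordan_Normal_Form"
    "Jordan_Normal_Form.Matrix_Kernel"
    "HOL-Computational_Algebra.Polynomial_Factorial"
    "HOL-Library.FuncSet"
begin

definition pencil :: "'a :: field mat \<Rightarrow> 'a mat \<Rightarrow> 'a poly mat" where
  "pencil F G = [:0, 1:] \<cdot>\<^sub>m map_mat (\<lambda>a. [:a:]) F - map_mat (\<lambda>a. [:a:]) G"

definition regular_pencil :: "'a :: field mat \<Rightarrow> 'a mat \<Rightarrow> bool" where
  "regular_pencil F G \<longleftrightarrow> dim_row F = dim_col F \<and> det (pencil F G) \<noteq> 0"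

abbreviation singular_pencil :: "'a :: field mat \<Rightarrow> 'a mat \<Rightarrow> bool" where
  "singular_pencil F G \<equiv> \<not> regular_pencil F G"

text \<open>The dimension of the right null space of the pencil over the field of rational
  functions \<open>'a poly fract\<close>; this is the number of column minimal indices, zero indices
  included.\<close>

definition right_null_dim :: "'a :: field mat \<Rightarrow> 'a mat \<Rightarrow> nat" where
  "right_null_dim F G = kernel_dim (map_mat to_fract (pencil F G))"

definition L_mat :: "nat \<Rightarrow> 'a :: field mat" where
  "L_mat e = mat e (Suc e) (\<lambda>(i, j). if j = i then 1 else 0)"

definition Lbar_mat :: "nat \<Rightarrow> 'a :: field mat" where
  "Lbar_mat e = mat e (Suc e) (\<lambda>(i, j). if j = Suc i then 1 else 0)"

text \<open>A Kronecker canonical form is described by the list \<open>ps\<close> of pairs \<open>(p\<^sub>j, a\<^sub>j)\<close> of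
  its finite elementary divisors, the list \<open>qs\<close> of degrees of its infinite elementary divisors,
  the lists \<open>es\<close> and \<open>zs\<close> of its nonzero column and row minimal indices, and the numbers
  \<open>g\<close> and \<open>h\<close> of its zero column and row minimal indices.\<close>

definition kronecker_data ::
  "(nat \<times> 'a) list \<Rightarrow> nat list \<Rightarrow> nat list \<Rightarrow> nat list \<Rightarrow> bool" where
  "kronecker_data ps qs es zs \<longleftrightarrow>
     (\<forall>(n, a) \<in> set ps. 0 < n) \<and> (\<forall>n \<in> set qs. 0 < n) \<and>
     (\<forall>n \<in> set es. 0 < n) \<and> sorted es \<and> (\<forall>n \<in> set zs. 0 < n) \<and> sorted zs"

definition kronecker_F ::
  "(nat \<times> 'a :: field) list \<Rightarrow> nat list \<Rightarrow> nat list \<Rightarrow> nat list \<Rightarrow> nat \<Rightarrow> nat \<Rightarrow> 'a mat" where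
  "kronecker_F ps qs es zs h g = diag_block_mat
     [1\<^sub>m (sum_list (map fst ps)),
      jordan_matrix (map (\<lambda>n. (n, 0)) qs),
      diag_block_mat (map L_mat es),
      diag_block_mat (map (\<lambda>n. (L_mat n)\<^sup>T) zs),
      0\<^sub>m h g]"

definition kronecker_G ::
  "(nat \<times> 'a :: field) list \<Rightarrow> nat list \<Rightarrow> nat list \<Rightarrow> nat list \<Rightarrow> nat \<Rightarrow> nat \<Rightarrow> 'a mat" where
  "kronecker_G ps qs es zs h g = diag_block_mat
     [jordan_matrix ps,
      1\<^sub>m (sum_list qs),
      diag_block_mat (map Lbar_mat es),
      diag_block_mat (map (\<lambda>n. (Lbar_mat n)\<^sup>T) zs),
      0\<^sub>m h g]"

definition first_cols :: "nat \<Rightarrow> 'a mat \<Rightarrow> 'a mat" where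
  "first_cols p Q = mat_of_cols (dim_row Q) (take p (cols Q))"

definition colspan :: "'a :: field mat \<Rightarrow> 'a vec set" where
  "colspan A = vec_space.col_space (dim_row A) A"

text \<open>Solutions are extensional functions on \<open>{k0..}\<close> (that is, \<open>undefined\<close> below
  \<open>k0\<close>), so that equality and cardinality are those of sequences indexed by \<open>k \<ge> k0\<close>.\<close>

definition solutions ::
  "'a :: field mat \<Rightarrow> 'a mat \<Rightarrow> int \<Rightarrow> 'a vec \<Rightarrow> (int \<Rightarrow> 'a vec) set" where
  "solutions F G k0 Y0 =
     {Y \<in> {k0..} \<rightarrow>\<^sub>E carrier_vec (dim_col F).
        Y k0 = Y0 \<and> (\<forall>k \<ge> k0. F *\<^sub>v Y (k + 1) = G *\<^sub>v Y k)}"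

end

theory Submission
  imports Defs
begin

text \<open>The coefficients of a polynomial null vector \<open>x\<^sub>0 + s x\<^sub>1 + \<dots> + s^N x\<^sub>N\<close> of \<open>s F - G\<close>
  satisfy \<open>G x\<^sub>0 = 0\<close>, \<open>F x\<^sub>n = G x\<^sub>n\<^sub>+\<^sub>1\<close> and \<open>F x\<^sub>N = 0\<close>. Read backwards, they are a finite
  excursion \<open>0, x\<^sub>N, \<dots>, x\<^sub>0, 0\<close> of the system \<open>F Y\<^sub>k\<^sub>+\<^sub>1 = G Y\<^sub>k\<close> from zero back to zero. So if
  the right null space is nonzero, any solution can be perturbed by such an excursion started after an
  arbitrary delay, and one solution yields infinitely many, over a finite field too
  (\<open>infinite_solutions_if_null_chain\<close>).

  If the right null space is zero, the Kronecker form has no blocks \<open>L\<^sub>\<epsilon>\<close> and no zero columns,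
  since each of these carries an explicit polynomial null vector (\<open>null_chain_kronecker\<close>). What
  remains is \<open>(I\<^sub>p, J\<^sub>p)\<close> together with the blocks of the infinite elementary divisors and of the row
  minimal indices. The blocks of these two kinds force their coordinates to satisfy
  \<open>X\<^sub>k(i) = X\<^sub>k\<^sub>+\<^sub>1(i + 1)\<close>, with zero past the last coordinate, so they admit the zero sequence only
  (\<open>rigid_if_shift\<close>). Hence in the coordinates given by \<open>Q\<close> a solution is \<open>J\<^sub>p^n Z\<close> padded with
  zeros, which is \<open>Q\<^sub>p J\<^sub>p^n Z\<close> in the original ones (\<open>solution_form\<close>, \<open>power_solution\<close>); a solution
  exists precisely for initial values in the column space of \<open>Q\<^sub>p\<close>, and it is then unique because
  the columns of \<open>Q\<^sub>p\<close> are independent.\<close>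

section \<open>Polynomial null vectors and their coefficient chains\<close>

text \<open>\<open>x 0, \<dots>, x N\<close> are the coefficients of a polynomial vector of degree \<open>N\<close> in the right null space
  of \<open>s F - G\<close>. The sequence is continued by zero so that the end condition \<open>F x\<^sub>N = 0\<close> is an instance
  of the recurrence.\<close>
definition null_chain :: "'a :: field mat \<Rightarrow> 'a mat \<Rightarrow> nat \<Rightarrow> (nat \<Rightarrow> 'a vec) \<Rightarrow> bool" where
  "null_chain F G N x \<longleftrightarrow>
     (\<forall>n. x n \<in> carrier_vec (dim_col F)) \<and>
     x N \<noteq> 0\<^sub>v (dim_col F) \<and> (\<forall>n > N. x n = 0\<^sub>v (dim_col F)) \<and>
     G *\<^sub>v x 0 = 0\<^sub>v (dim_row G) \<and> (\<forall>n. F *\<^sub>v x n = G *\<^sub>v x (Suc n))"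

lemma kernel_dim_eq_0_iff:
  fixes A :: "'a :: field mat"
  assumes A: "A \<in> carrier_mat nr nc"
  shows "kernel_dim A = 0 \<longleftrightarrow> (\<forall>v \<in> carrier_vec nc. A *\<^sub>v v = 0\<^sub>v nr \<longrightarrow> v = 0\<^sub>v nc)"
proof -
  interpret kernel nr nc A by unfold_locales (rule A)
  obtain B where B: "finite B" "basis B"
    using kernel_basis_exists[OF A] by blast
  have dim: "kernel_dim A = card B"
    using Ker.dim_basis[OF B] by simp
  have B_sub: "B \<subseteq> mat_kernel A" and li: "lin_indpt B" and gen: "span B = mat_kernel A"
    using B(2) unfolding Ker.basis_def by auto
  have "B = {} \<longleftrightarrow> mat_kernel A \<subseteq> {0\<^sub>v nc}"
  proof
    assume "B = {}"
    then have "span B = {0\<^sub>v nc}"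
      using Ker.span_empty by simp
    then show "mat_kernel A \<subseteq> {0\<^sub>v nc}"
      using gen by simp
  next
    assume "mat_kernel A \<subseteq> {0\<^sub>v nc}"
    moreover have "(UNIV :: 'a set) \<noteq> {0}"
      by (metis UNIV_I singletonD zero_neq_one)
    then have "0\<^sub>v nc \<notin> B"
      using Ker.zero_nin_lin_indpt[OF B_sub] li by simp
    ultimately show "B = {}"
      using B_sub by blast
  qed
  moreover have "kernel_dim A = 0 \<longleftrightarrow> B = {}"
    unfolding dim using B(1) by (rule card_0_eq)
  ultimately show ?thesis
    by (auto simp only: mat_kernel[OF A])
qed

lemma ex_common_denominator:
  fixes f :: "nat \<Rightarrow> 'a :: idom fract"
  shows "\<exists>c. c \<noteq> 0 \<and> (\<forall>i < n. \<exists>p. to_fract c * f i = to_fract p)"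
proof (induction n)
  case (Suc n)
  then obtain c where c: "c \<noteq> 0" "\<forall>i < n. \<exists>p. to_fract c * f i = to_fract p"
    by blast
  obtain a b where f: "f n = Fract a b" and b: "b \<noteq> 0"
    by (cases "f n")
  have "\<exists>p. to_fract (b * c) * f i = to_fract p" if "i < Suc n" for i
  proof (cases "i = n")
    case True
    have "to_fract (b * c) * f i = to_fract (a * c)"
      unfolding True f using b by (simp add: to_fract_def eq_fract ac_simps)
    then show ?thesis ..
  next
    case False
    then obtain p where "to_fract c * f i = to_fract p"
      using c(2) \<open>i < Suc n\<close> by (metis less_antisym)
    then have "to_fract (b * c) * f i = to_fract (b * p)"
      by (simp add: mult.assoc)
    then show ?thesis ..
  qed
  then show ?case
    using b c(1) by (intro exI[of _ "b * c"]) auto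
qed (auto intro: exI[of _ 1])

text \<open>A null vector over the fraction field becomes one over the ring itself when it is multiplied by a
  common denominator of its entries.\<close>
lemma ex_fract_null_vector_iff:
  fixes A :: "'a :: idom mat"
  assumes A: "A \<in> carrier_mat nr nc"
  shows "(\<exists>w \<in> carrier_vec nc. map_mat to_fract A *\<^sub>v w = 0\<^sub>v nr \<and> w \<noteq> 0\<^sub>v nc) \<longleftrightarrow>
         (\<exists>v \<in> carrier_vec nc. A *\<^sub>v v = 0\<^sub>v nr \<and> v \<noteq> 0\<^sub>v nc)"
proof
  interpret fr: inj_comm_ring_hom "to_fract :: 'a \<Rightarrow> 'a fract"
    by unfold_locales auto
  {
    assume "\<exists>w \<in> carrier_vec nc. map_mat to_fract A *\<^sub>v w = 0\<^sub>v nr \<and> w \<noteq> 0\<^sub>v nc"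
    then obtain w where w: "w \<in> carrier_vec nc" "map_mat to_fract A *\<^sub>v w = 0\<^sub>v nr" "w \<noteq> 0\<^sub>v nc"
      by blast
    obtain c p where c: "c \<noteq> 0" and p: "\<And>i. i < nc \<Longrightarrow> to_fract c * w $ i = to_fract (p i)"
      using ex_common_denominator[of nc "\<lambda>i. w $ i"] by metis
    define v where "v = vec nc p"
    have v: "v \<in> carrier_vec nc"
      by (simp add: v_def)
    have cw: "map_vec to_fract v = to_fract c \<cdot>\<^sub>v w"
      using w(1) p by (intro eq_vecI) (auto simp: v_def)
    have "map_vec to_fract (A *\<^sub>v v) = to_fract c \<cdot>\<^sub>v (map_mat to_fract A *\<^sub>v w)"
      using fr.mult_mat_vec_hom[OF A v] mult_mat_vec[of "map_mat to_fract A" nr nc w] A w(1)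
      by (simp add: cw)
    also have "\<dots> = map_vec to_fract (0\<^sub>v nr)"
      using w(2) by (intro eq_vecI) auto
    finally have "A *\<^sub>v v = 0\<^sub>v nr"
      by (simp only: fr.vec_hom_inj)
    moreover have "v \<noteq> 0\<^sub>v nc"
    proof
      assume v0: "v = 0\<^sub>v nc"
      have "w $ i = 0" if "i < nc" for i
      proof -
        have "v $ i = 0"
          using v0 that by simp
        then have "p i = 0"
          using that by (simp add: v_def)
        with p[OF that] c show ?thesis
          by simp
      qed
      then show False
        using w(1,3) by (metis eq_vecI carrier_vecD index_zero_vec)
    qed
    ultimately show "\<exists>v \<in> carrier_vec nc. A *\<^sub>v v = 0\<^sub>v nr \<and> v \<noteq> 0\<^sub>v nc"
      using v by blast
  }
  {
    assume "\<exists>v \<in> carrier_vec nc. A *\<^sub>v v = 0\<^sub>v nr \<and> v \<noteq> 0\<^sub>v nc"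
    then obtain v where v: "v \<in> carrier_vec nc" "A *\<^sub>v v = 0\<^sub>v nr" "v \<noteq> 0\<^sub>v nc"
      by blast
    have "map_mat to_fract A *\<^sub>v map_vec to_fract v = map_vec to_fract (0\<^sub>v nr)"
      using fr.mult_mat_vec_hom[OF A v(1)] v(2) by simp
    moreover have "map_vec to_fract v \<noteq> map_vec to_fract (0\<^sub>v nc)"
      using v(3) fr.vec_hom_inj by metis
    moreover have "map_vec to_fract (0\<^sub>v k :: 'a vec) = 0\<^sub>v k" for k
      by (intro eq_vecI) auto
    ultimately show "\<exists>w \<in> carrier_vec nc. map_mat to_fract A *\<^sub>v w = 0\<^sub>v nr \<and> w \<noteq> 0\<^sub>v nc"
      using v(1) by (intro bexI[of _ "map_vec to_fract v"]) auto
  }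
qed

lemma pencil_carrier:
  "F \<in> carrier_mat r m \<Longrightarrow> G \<in> carrier_mat r m \<Longrightarrow> pencil F G \<in> carrier_mat r m"
  unfolding pencil_def by auto

text \<open>Multiplication by the indeterminate shifts the coefficients of \<open>F v\<close> up by one degree; there is
  no contribution of \<open>F\<close> in degree \<open>0\<close>.\<close>
lemma coeff_pencil_mult_vec:
  assumes F: "F \<in> carrier_mat r m" and G: "G \<in> carrier_mat r m"
    and v: "v \<in> carrier_vec m" and i: "i < r"
  shows "coeff ((pencil F G *\<^sub>v v) $ i) k =
    (case k of 0 \<Rightarrow> 0 | Suc k' \<Rightarrow> (F *\<^sub>v map_vec (\<lambda>q. coeff q k') v) $ i) -
    (G *\<^sub>v map_vec (\<lambda>q. coeff q k) v) $ i"
proof -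
  have entry: "coeff (([:0, 1:] * [:a:] - [:b:]) * q) k =
      (case k of 0 \<Rightarrow> 0 | Suc k' \<Rightarrow> a * coeff q k') - b * coeff q k" for a b :: 'a and q
    by (simp add: left_diff_distrib coeff_pCons split: nat.splits)
  have "(pencil F G *\<^sub>v v) $ i =
      (\<Sum>j = 0..<m. ([:0, 1:] * [:F $$ (i, j):] - [:G $$ (i, j):]) * v $ j)"
    using F G v i unfolding pencil_def by (auto simp: scalar_prod_def intro!: sum.cong)
  then have "coeff ((pencil F G *\<^sub>v v) $ i) k =
      (\<Sum>j = 0..<m. (case k of 0 \<Rightarrow> 0 | Suc k' \<Rightarrow> F $$ (i, j) * coeff (v $ j) k') -
         G $$ (i, j) * coeff (v $ j) k)"
    by (simp only: coeff_sum entry)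
  also have "\<dots> = (case k of 0 \<Rightarrow> 0 | Suc k' \<Rightarrow> (F *\<^sub>v map_vec (\<lambda>q. coeff q k') v) $ i) -
      (G *\<^sub>v map_vec (\<lambda>q. coeff q k) v) $ i"
    using F G v i by (auto simp: scalar_prod_def sum_subtractf split: nat.splits)
  finally show ?thesis .
qed

lemma pencil_mult_vec_eq_0_iff:
  assumes F: "F \<in> carrier_mat r m" and G: "G \<in> carrier_mat r m" and v: "v \<in> carrier_vec m"
  defines "x \<equiv> \<lambda>n. map_vec (\<lambda>q. coeff q n) v"
  shows "pencil F G *\<^sub>v v = 0\<^sub>v r \<longleftrightarrow>
    G *\<^sub>v x 0 = 0\<^sub>v r \<and> (\<forall>n. F *\<^sub>v x n = G *\<^sub>v x (Suc n))"
proof -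
  have zero_or_Suc: "(\<forall>k. P k) \<longleftrightarrow> P 0 \<and> (\<forall>n. P (Suc n))" for P :: "nat \<Rightarrow> bool"
    by (metis not0_implies_Suc)
  have "pencil F G *\<^sub>v v = 0\<^sub>v r \<longleftrightarrow> (\<forall>k. \<forall>i < r. coeff ((pencil F G *\<^sub>v v) $ i) k = 0)"
    using pencil_carrier[OF F G] by (auto simp: vec_eq_iff poly_eq_iff)
  also have "\<dots> \<longleftrightarrow> (\<forall>k. \<forall>i < r. (case k of 0 \<Rightarrow> 0 | Suc k' \<Rightarrow> (F *\<^sub>v x k') $ i) = (G *\<^sub>v x k) $ i)"
    by (simp add: x_def coeff_pencil_mult_vec[OF F G v] cong: nat.case_cong)
  also have "\<dots> \<longleftrightarrow> (\<forall>i < r. (G *\<^sub>v x 0) $ i = 0) \<and>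
      (\<forall>n. \<forall>i < r. (F *\<^sub>v x n) $ i = (G *\<^sub>v x (Suc n)) $ i)"
    by (subst zero_or_Suc) auto
  also have "\<dots> \<longleftrightarrow> G *\<^sub>v x 0 = 0\<^sub>v r \<and> (\<forall>n. F *\<^sub>v x n = G *\<^sub>v x (Suc n))"
    using F G by (auto simp: vec_eq_iff)
  finally show ?thesis .
qed

lemma ex_null_chain_iff:
  assumes F: "F \<in> carrier_mat r m" and G: "G \<in> carrier_mat r m"
  shows "(\<exists>N x. null_chain F G N x) \<longleftrightarrow>
         (\<exists>v \<in> carrier_vec m. pencil F G *\<^sub>v v = 0\<^sub>v r \<and> v \<noteq> 0\<^sub>v m)"
proof
  assume "\<exists>N x. null_chain F G N x"
  then obtain N x where x: "\<And>n. x n \<in> carrier_vec m" and xN: "x N \<noteq> 0\<^sub>v m"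
    and beyond: "\<And>n. N < n \<Longrightarrow> x n = 0\<^sub>v m"
    and start: "G *\<^sub>v x 0 = 0\<^sub>v r" and step: "\<And>n. F *\<^sub>v x n = G *\<^sub>v x (Suc n)"
    using F G unfolding null_chain_def by auto
  define v where "v = vec m (\<lambda>j. \<Sum>n\<le>N. monom (x n $ j) n)"
  have v: "v \<in> carrier_vec m"
    by (simp add: v_def)
  have coeffs: "map_vec (\<lambda>q. coeff q n) v = x n" for n
  proof (rule eq_vecI)
    fix j assume "j < dim_vec (x n)"
    then have j: "j < m"
      using x[of n] by simp
    then show "map_vec (\<lambda>q. coeff q n) v $ j = x n $ j"
      using beyond[of n] by (auto simp: v_def coeff_sum not_less[symmetric])
  qed (use x[of n] in \<open>simp add: v_def\<close>)
  have "pencil F G *\<^sub>v v = 0\<^sub>v r"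
    using pencil_mult_vec_eq_0_iff[OF F G v] start step by (simp add: coeffs)
  moreover have "v \<noteq> 0\<^sub>v m"
  proof
    assume "v = 0\<^sub>v m"
    then have "map_vec (\<lambda>q. coeff q N) v = 0\<^sub>v m"
      by auto
    with xN show False
      by (simp add: coeffs)
  qed
  ultimately show "\<exists>v \<in> carrier_vec m. pencil F G *\<^sub>v v = 0\<^sub>v r \<and> v \<noteq> 0\<^sub>v m"
    using v by blast
next
  assume "\<exists>v \<in> carrier_vec m. pencil F G *\<^sub>v v = 0\<^sub>v r \<and> v \<noteq> 0\<^sub>v m"
  then obtain v where v: "v \<in> carrier_vec m" "pencil F G *\<^sub>v v = 0\<^sub>v r" "v \<noteq> 0\<^sub>v m"
    by blast
  define x where "x n = map_vec (\<lambda>q. coeff q n) v" for n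
  define S where "S = {n. x n \<noteq> 0\<^sub>v m}"
  have x: "x n \<in> carrier_vec m" for n
    using v(1) by (simp add: x_def)
  obtain j where j: "j < m" "v $ j \<noteq> 0"
    using v(1,3) by (metis eq_vecI carrier_vecD index_zero_vec)
  have "x (degree (v $ j)) $ j \<noteq> 0"
    using v(1) j by (simp add: x_def)
  then have "degree (v $ j) \<in> S"
    using j(1) by (auto simp: S_def)
  then have "S \<noteq> {}"
    by blast
  have "x n = 0\<^sub>v m" if "(\<Sum>j<m. degree (v $ j)) < n" for n
  proof (rule eq_vecI)
    fix j assume "j < dim_vec (0\<^sub>v m :: 'a vec)"
    then have j: "j < m"
      by simp
    then have "degree (v $ j) \<le> (\<Sum>j<m. degree (v $ j))"
      by (intro member_le_sum) auto
    then show "x n $ j = 0\<^sub>v m $ j"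
      using j that v(1) by (simp add: x_def coeff_eq_0)
  qed (use v(1) in \<open>simp add: x_def\<close>)
  then have "S \<subseteq> {..(\<Sum>j<m. degree (v $ j))}"
    unfolding S_def by (auto simp: not_less[symmetric])
  then have "finite S"
    using finite_subset by blast
  have "x n = 0\<^sub>v m" if "Max S < n" for n
    using Max_ge[OF \<open>finite S\<close>, of n] that unfolding S_def by auto
  moreover have "x (Max S) \<noteq> 0\<^sub>v m"
    using Max_in[OF \<open>finite S\<close> \<open>S \<noteq> {}\<close>] unfolding S_def by simp
  ultimately have "null_chain F G (Max S) x"
    using pencil_mult_vec_eq_0_iff[OF F G v(1)] v(2) x F G
    unfolding null_chain_def x_def by simp
  then show "\<exists>N x. null_chain F G N x"
    by blast
qed

lemma right_null_dim_eq_0_iff: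
  assumes F: "F \<in> carrier_mat r m" and G: "G \<in> carrier_mat r m"
  shows "right_null_dim F G = 0 \<longleftrightarrow> (\<nexists>N x. null_chain F G N x)"
proof -
  have "map_mat to_fract (pencil F G) \<in> carrier_mat r m"
    using pencil_carrier[OF F G] by simp
  then have "right_null_dim F G = 0 \<longleftrightarrow>
      \<not> (\<exists>w \<in> carrier_vec m. map_mat to_fract (pencil F G) *\<^sub>v w = 0\<^sub>v r \<and> w \<noteq> 0\<^sub>v m)"
    unfolding right_null_dim_def by (subst kernel_dim_eq_0_iff) auto
  then show ?thesis
    by (simp only: ex_fract_null_vector_iff[OF pencil_carrier[OF F G]] ex_null_chain_iff[OF F G])
qed

section \<open>Infinitely many solutions from a polynomial null vector\<close>

text \<open>Running the chain backwards and extending it by zero in both directions gives a solution \<open>w\<close> of the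
  homogeneous system on all of \<open>\<int>\<close> that vanishes at negative times. Adding \<open>w\<close> with delay \<open>d + 1\<close>
  keeps the initial value, and different delays give different solutions because they first deviate
  from \<open>Y\<close> at different times.\<close>
lemma infinite_solutions_if_null_chain:
  assumes F: "F \<in> carrier_mat r m" and G: "G \<in> carrier_mat r m"
    and chain: "null_chain F G N x" and Y: "Y \<in> solutions F G k0 Y0"
  shows "infinite (solutions F G k0 Y0)"
proof -
  have x: "x n \<in> carrier_vec m" and xN: "x N \<noteq> 0\<^sub>v m"
    and beyond: "N < n \<Longrightarrow> x n = 0\<^sub>v m"
    and start: "G *\<^sub>v x 0 = 0\<^sub>v r" and step: "F *\<^sub>v x n = G *\<^sub>v x (Suc n)" for n
    using chain F G unfolding null_chain_def by auto
  define w where "w i = (if i \<le> int N then x (nat (int N - i)) else 0\<^sub>v m)" for i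
  have w: "w i \<in> carrier_vec m" for i
    using x by (simp add: w_def)
  have w_neg: "w i = 0\<^sub>v m" if "i < 0" for i
    using that beyond by (simp add: w_def)
  have w_0: "w 0 \<noteq> 0\<^sub>v m"
    using xN by (simp add: w_def)
  have F0: "F *\<^sub>v 0\<^sub>v m = 0\<^sub>v r" and G0: "G *\<^sub>v 0\<^sub>v m = 0\<^sub>v r"
    using F G by auto
  have w_step: "F *\<^sub>v w (i + 1) = G *\<^sub>v w i" for i
  proof -
    consider "i < int N" | "i = int N" | "int N < i"
      by linarith
    then show ?thesis
    proof cases
      case 1
      then have "Suc (nat (int N - (i + 1))) = nat (int N - i)"
        by simp
      with 1 step[of "nat (int N - (i + 1))"] show ?thesis
        by (simp add: w_def)
    qed (use start in \<open>simp_all add: w_def F0 G0\<close>)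
  qed
  define Yd where "Yd d = restrict (\<lambda>k. Y k + w (k - k0 - 1 - int d)) {k0..}" for d :: nat
  have Yk: "Y k \<in> carrier_vec m" if "k0 \<le> k" for k
    using Y F that unfolding solutions_def by auto
  have "Yd d \<in> solutions F G k0 Y0" for d
  proof -
    have "Yd d k0 = Y0"
      using Yk[of k0] w_neg[of "- 1 - int d"] Y by (simp add: Yd_def solutions_def)
    moreover have "F *\<^sub>v Yd d (k + 1) = G *\<^sub>v Yd d k" if "k0 \<le> k" for k
    proof -
      have "k + 1 - k0 - 1 - int d = (k - k0 - 1 - int d) + 1"
        by simp
      then have "F *\<^sub>v w (k + 1 - k0 - 1 - int d) = G *\<^sub>v w (k - k0 - 1 - int d)"
        by (simp only: w_step)
      moreover have "F *\<^sub>v Y (k + 1) = G *\<^sub>v Y k"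
        using Y that by (simp add: solutions_def)
      ultimately show ?thesis
        using that Yk[of k] Yk[of "k + 1"]
          mult_add_distrib_mat_vec[OF F Yk w, of "k + 1"]
          mult_add_distrib_mat_vec[OF G Yk w, of k]
        by (simp add: Yd_def)
    qed
    ultimately show ?thesis
      using Yk w F by (auto simp: solutions_def Yd_def)
  qed
  then have range: "range Yd \<subseteq> solutions F G k0 Y0"
    by blast
  \<comment> \<open>The time \<open>k\<close> below is the one at which the earlier excursion leaves zero with \<open>w 0 = x N\<close>,
    while the later one still rests.\<close>
  have neq: "Yd d \<noteq> Yd d'" if "d < d'" for d d'
  proof
    define k where "k = k0 + 1 + int d"
    assume "Yd d = Yd d'"
    then have "Yd d k = Yd d' k"
      by simp
    then have "Y k + w 0 = Y k + w (int d - int d')"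
      by (simp add: Yd_def k_def)
    also have "w (int d - int d') = 0\<^sub>v m"
      using that by (intro w_neg) simp
    finally have eq: "Y k + w 0 = Y k + 0\<^sub>v m" .
    have "w 0 = 0\<^sub>v m"
    proof (rule eq_vecI)
      fix i assume i: "i < dim_vec (0\<^sub>v m :: 'a vec)"
      have "(Y k + w 0) $ i = (Y k + 0\<^sub>v m) $ i"
        by (simp only: eq)
      then show "w 0 $ i = 0\<^sub>v m $ i"
        using i w[of 0] by simp
    qed (use w[of 0] in simp)
    with w_0 show False ..
  qed
  have "inj Yd"
    by (rule injI) (metis neq nat_neq_iff)
  then show ?thesis
    using range range_inj_infinite infinite_super by blast
qed

section \<open>Direct sums and equivalence of pencils\<close>

definition direct_sum_mat :: "'a :: zero mat \<Rightarrow> 'a mat \<Rightarrow> 'a mat" where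
  "direct_sum_mat A B =
     four_block_mat A (0\<^sub>m (dim_row A) (dim_col B)) (0\<^sub>m (dim_row B) (dim_col A)) B"

lemma diag_block_mat_Cons: "diag_block_mat (A # As) = direct_sum_mat A (diag_block_mat As)"
  by (simp add: direct_sum_mat_def Let_def)

lemma direct_sum_empty [simp]: "direct_sum_mat A (0\<^sub>m 0 0) = A"
  using diag_block_mat_Cons[of A "[]"] by (simp del: diag_block_mat.simps(2))

lemma dim_direct_sum [simp]:
  "dim_row (direct_sum_mat A B) = dim_row A + dim_row B"
  "dim_col (direct_sum_mat A B) = dim_col A + dim_col B"
  by (simp_all add: direct_sum_mat_def)

lemma direct_sum_mult_vec [simp]:
  fixes A B :: "'a :: semiring_1 mat"
  assumes "a \<in> carrier_vec (dim_col A)" and "b \<in> carrier_vec (dim_col B)"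
  shows "direct_sum_mat A B *\<^sub>v (a @\<^sub>v b) = (A *\<^sub>v a) @\<^sub>v (B *\<^sub>v b)"
proof -
  have "direct_sum_mat A B *\<^sub>v (a @\<^sub>v b) =
      (A *\<^sub>v a + 0\<^sub>m (dim_row A) (dim_col B) *\<^sub>v b) @\<^sub>v (0\<^sub>m (dim_row B) (dim_col A) *\<^sub>v a + B *\<^sub>v b)"
    unfolding direct_sum_mat_def using assms by (intro four_block_mat_mult_vec) auto
  moreover have "0\<^sub>m (dim_row A) (dim_col B) *\<^sub>v b = 0\<^sub>v (dim_row A)"
    "0\<^sub>m (dim_row B) (dim_col A) *\<^sub>v a = 0\<^sub>v (dim_row B)"
    using assms by auto
  moreover have "A *\<^sub>v a + 0\<^sub>v (dim_row A) = A *\<^sub>v a" "0\<^sub>v (dim_row B) + B *\<^sub>v b = B *\<^sub>v b"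
    by auto
  ultimately show ?thesis
    by simp
qed

definition same_dim :: "'a mat \<Rightarrow> 'a mat \<Rightarrow> bool" where
  "same_dim A B \<longleftrightarrow> dim_row A = dim_row B \<and> dim_col A = dim_col B"

lemma zero_vec_append [simp]: "0\<^sub>v n @\<^sub>v 0\<^sub>v k = 0\<^sub>v (n + k)"
  by auto

lemma append_vec_eq_zero_iff [simp]:
  assumes "a \<in> carrier_vec n" and "b \<in> carrier_vec k"
  shows "a @\<^sub>v b = 0\<^sub>v (n + k) \<longleftrightarrow> a = 0\<^sub>v n \<and> b = 0\<^sub>v k"
  using append_vec_eq[OF assms(1) zero_carrier_vec, of b "0\<^sub>v k"] by simp

lemma mult_mat_zero_vec [simp]: "A *\<^sub>v 0\<^sub>v (dim_col A) = 0\<^sub>v (dim_row A)"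
  by auto

lemma null_chain_direct_sum_left:
  assumes "null_chain A1 B1 N x" and "same_dim A1 B1" and "same_dim A2 B2"
  shows "null_chain (direct_sum_mat A1 A2) (direct_sum_mat B1 B2) N (\<lambda>n. x n @\<^sub>v 0\<^sub>v (dim_col A2))"
proof -
  have B: "dim_col B1 = dim_col A1" "dim_row B1 = dim_row A1"
    "dim_col B2 = dim_col A2" "dim_row B2 = dim_row A2"
    using assms(2,3) by (auto simp: same_dim_def)
  have "B2 *\<^sub>v 0\<^sub>v (dim_col A2) = 0\<^sub>v (dim_row A2)"
    using mult_mat_zero_vec[of B2] by (simp only: B)
  then show ?thesis
    using assms(1) unfolding null_chain_def by (simp add: B)
qed

lemma null_chain_direct_sum_right:
  assumes "null_chain A2 B2 N x" and "same_dim A1 B1" and "same_dim A2 B2"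
  shows "null_chain (direct_sum_mat A1 A2) (direct_sum_mat B1 B2) N (\<lambda>n. 0\<^sub>v (dim_col A1) @\<^sub>v x n)"
proof -
  have B: "dim_col B1 = dim_col A1" "dim_row B1 = dim_row A1"
    "dim_col B2 = dim_col A2" "dim_row B2 = dim_row A2"
    using assms(2,3) by (auto simp: same_dim_def)
  have "B1 *\<^sub>v 0\<^sub>v (dim_col A1) = 0\<^sub>v (dim_row A1)"
    using mult_mat_zero_vec[of B1] by (simp only: B)
  then show ?thesis
    using assms(1) unfolding null_chain_def by (simp add: B)
qed

lemma same_dim_direct_sum:
  "same_dim A1 B1 \<Longrightarrow> same_dim A2 B2 \<Longrightarrow> same_dim (direct_sum_mat A1 A2) (direct_sum_mat B1 B2)"
  by (simp add: same_dim_def)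

lemma same_dim_diag_block_mat:
  "(\<And>t. t \<in> set ts \<Longrightarrow> same_dim (f t) (g t)) \<Longrightarrow>
    same_dim (diag_block_mat (map f ts)) (diag_block_mat (map g ts))"
  by (induction ts) (simp_all add: diag_block_mat_Cons same_dim_direct_sum
      del: diag_block_mat.simps(2), simp add: same_dim_def)

text \<open>A single block with a nonzero null space suffices, as its chain can be padded with zeros in the
  coordinates of the other blocks.\<close>

lemma null_chain_diag_block_mat:
  assumes "\<And>t. t \<in> set ts \<Longrightarrow> same_dim (f t) (g t)"
    and "t \<in> set ts" and "\<exists>N x. null_chain (f t) (g t) N x"
  shows "\<exists>N x. null_chain (diag_block_mat (map f ts)) (diag_block_mat (map g ts)) N x"
  using assms
proof (induction ts)
  case (Cons s ts)
  have dims: "same_dim (f s) (g s)" "same_dim (diag_block_mat (map f ts)) (diag_block_mat (map g ts))"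
    using Cons.prems(1) by (auto intro: same_dim_diag_block_mat)
  show ?case
  proof (cases "t = s")
    case True
    then obtain N x where "null_chain (f s) (g s) N x"
      using Cons.prems(3) by blast
    from null_chain_direct_sum_left[OF this dims] show ?thesis
      unfolding list.map diag_block_mat_Cons by blast
  next
    case False
    then obtain N x where
      "null_chain (diag_block_mat (map f ts)) (diag_block_mat (map g ts)) N x"
      using Cons by auto
    from null_chain_direct_sum_right[OF this dims] show ?thesis
      unfolding list.map diag_block_mat_Cons by blast
  qed
qed simp

lemma mult_mat_vec_left_inverse:
  fixes A B :: "'a :: semiring_1 mat"
  assumes "A \<in> carrier_mat n n" and "B \<in> carrier_mat n n" and "B * A = 1\<^sub>m n" and "v \<in> carrier_vec n"
  shows "B *\<^sub>v (A *\<^sub>v v) = v"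
  using assoc_mult_mat_vec[OF assms(2,1,4)] assms(3) one_mult_mat_vec[OF assms(4)] by simp

lemma equivalent_pencil_mult_vec:
  assumes "A \<in> carrier_mat r m" and "P \<in> carrier_mat r r" and "Q \<in> carrier_mat m m"
    and "v \<in> carrier_vec m"
  shows "(P * A * Q) *\<^sub>v v = P *\<^sub>v (A *\<^sub>v (Q *\<^sub>v v))"
proof -
  have "(P * A * Q) *\<^sub>v v = (P * A) *\<^sub>v (Q *\<^sub>v v)"
    using assms by (intro assoc_mult_mat_vec) auto
  also have "\<dots> = P *\<^sub>v (A *\<^sub>v (Q *\<^sub>v v))"
    using assms by (intro assoc_mult_mat_vec) auto
  finally show ?thesis .
qed

text \<open>\<open>Q\<close> maps null vectors of \<open>P (s F - G) Q\<close> to null vectors of \<open>s F - G\<close>: the factor \<open>P\<close>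
  can be cancelled from the left, and injectivity of \<open>Q\<close> keeps the degree.\<close>

lemma null_chain_equivalent_pencil:
  assumes F: "F \<in> carrier_mat r m" and G: "G \<in> carrier_mat r m"
    and P: "P \<in> carrier_mat r r" and P': "P' \<in> carrier_mat r r" "P' * P = 1\<^sub>m r"
    and Q: "Q \<in> carrier_mat m m" and Q': "Q' \<in> carrier_mat m m" "Q' * Q = 1\<^sub>m m"
    and chain: "null_chain (P * F * Q) (P * G * Q) N x"
  shows "null_chain F G N (\<lambda>n. Q *\<^sub>v x n)"
proof -
  have x: "x n \<in> carrier_vec m" and xN: "x N \<noteq> 0\<^sub>v m"
    and beyond: "N < n \<Longrightarrow> x n = 0\<^sub>v m"
    and start: "(P * G * Q) *\<^sub>v x 0 = 0\<^sub>v r"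
    and step: "(P * F * Q) *\<^sub>v x n = (P * G * Q) *\<^sub>v x (Suc n)" for n
    using chain F G P Q unfolding null_chain_def by auto
  have undo_P: "A *\<^sub>v (Q *\<^sub>v u) = P' *\<^sub>v ((P * A * Q) *\<^sub>v u)"
    if A: "A \<in> carrier_mat r m" and u: "u \<in> carrier_vec m" for A u
  proof -
    have "A *\<^sub>v (Q *\<^sub>v u) \<in> carrier_vec r"
      using A Q u by auto
    then show ?thesis
      by (simp only: equivalent_pencil_mult_vec[OF A P Q u] mult_mat_vec_left_inverse[OF P P'])
  qed
  have "F *\<^sub>v (Q *\<^sub>v x n) = G *\<^sub>v (Q *\<^sub>v x (Suc n))" for n
    by (simp add: undo_P F G x step)
  moreover have "G *\<^sub>v (Q *\<^sub>v x 0) = 0\<^sub>v r"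
    using P'(1) mult_mat_zero_vec[of P'] by (simp add: undo_P G x start)
  moreover have "Q *\<^sub>v x N \<noteq> 0\<^sub>v m"
  proof
    assume "Q *\<^sub>v x N = 0\<^sub>v m"
    then have "x N = Q' *\<^sub>v 0\<^sub>v m"
      using mult_mat_vec_left_inverse[OF Q Q' x, of N] by simp
    with xN Q'(1) show False
      by auto
  qed
  ultimately show ?thesis
    unfolding null_chain_def using F G Q x beyond by auto
qed

section \<open>Null vectors of the blocks of column minimal indices\<close>

text \<open>The chain of the polynomial null vector \<open>(1, s, \<dots>, s^e)\<close>.\<close>

lemma null_chain_L_block: "null_chain (L_mat e) (Lbar_mat e) e
  (\<lambda>n. if n \<le> e then unit_vec (Suc e) n else 0\<^sub>v (Suc e))"
proof -
  have L: "L_mat e *\<^sub>v v = vec e (\<lambda>i. v $ i)" if "v \<in> carrier_vec (Suc e)" for v :: "'a vec"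
    using that by (intro eq_vecI)
      (auto simp: L_mat_def scalar_prod_def if_distrib[of "\<lambda>c. c * _"] cong: if_cong)
  have Lbar: "Lbar_mat e *\<^sub>v v = vec e (\<lambda>i. v $ Suc i)" if "v \<in> carrier_vec (Suc e)" for v :: "'a vec"
    using that by (intro eq_vecI)
      (auto simp: Lbar_mat_def scalar_prod_def if_distrib[of "\<lambda>c. c * _"] cong: if_cong)
  have "unit_vec (Suc e) e $ e = (1 :: 'a)"
    by simp
  then have "unit_vec (Suc e) e \<noteq> (0\<^sub>v (Suc e) :: 'a vec)"
    by (metis index_zero_vec(1) lessI zero_neq_one)
  then show ?thesis
    unfolding null_chain_def
    by (auto simp: L Lbar L_mat_def[THEN arg_cong[of _ _ dim_col]] Lbar_mat_def[THEN arg_cong[of _ _ dim_row]]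
       unit_vec_def intro!: eq_vecI)
qed

lemma null_chain_zero_block:
  assumes "0 < g"
  shows "null_chain (0\<^sub>m h g) (0\<^sub>m h g) 0 (\<lambda>n. if n = 0 then unit_vec g 0 else 0\<^sub>v g)"
proof -
  have "unit_vec g 0 $ 0 = (1 :: 'a)"
    using assms by simp
  then have "unit_vec g 0 \<noteq> (0\<^sub>v g :: 'a vec)"
    using assms by (metis index_zero_vec(1) zero_neq_one)
  then show ?thesis
    unfolding null_chain_def by auto
qed

section \<open>Blocks without nonzero solutions\<close>

text \<open>The solutions of the system with the initial value left free, indexed by the time elapsed since
  the initial moment.\<close>

definition trajectory :: "'a :: semiring_0 mat \<Rightarrow> 'a mat \<Rightarrow> (nat \<Rightarrow> 'a vec) \<Rightarrow> bool" where
  "trajectory A B X \<longleftrightarrow>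
     (\<forall>n. X n \<in> carrier_vec (dim_col A)) \<and> (\<forall>n. A *\<^sub>v X (Suc n) = B *\<^sub>v X n)"

text \<open>A rigid pencil is one that contributes nothing to the solutions of a system of which it is a direct
  summand: no initial value other than zero can be continued for all times.\<close>

definition rigid :: "'a :: semiring_0 mat \<Rightarrow> 'a mat \<Rightarrow> bool" where
  "rigid A B \<longleftrightarrow> (\<forall>X. trajectory A B X \<longrightarrow> (\<forall>n. X n = 0\<^sub>v (dim_col A)))"

lemma trajectory_direct_sum:
  fixes A1 A2 B1 B2 :: "'a :: semiring_1 mat"
  assumes X: "trajectory (direct_sum_mat A1 A2) (direct_sum_mat B1 B2) X"
    and dims: "same_dim A1 B1" "same_dim A2 B2"
  shows "trajectory A1 B1 (\<lambda>n. vec_first (X n) (dim_col A1))"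
    and "trajectory A2 B2 (\<lambda>n. vec_last (X n) (dim_col A2))"
    and "X n = vec_first (X n) (dim_col A1) @\<^sub>v vec_last (X n) (dim_col A2)"
proof -
  let ?Y = "\<lambda>n. vec_first (X n) (dim_col A1)" and ?Z = "\<lambda>n. vec_last (X n) (dim_col A2)"
  have B: "dim_col B1 = dim_col A1" "dim_row B1 = dim_row A1" "dim_col B2 = dim_col A2"
    using dims by (auto simp: same_dim_def)
  have split: "?Y n @\<^sub>v ?Z n = X n" for n
    using X by (simp add: trajectory_def)
  then show "X n = ?Y n @\<^sub>v ?Z n"
    by simp
  have "A1 *\<^sub>v ?Y (Suc n) = B1 *\<^sub>v ?Y n \<and> A2 *\<^sub>v ?Z (Suc n) = B2 *\<^sub>v ?Z n" for n
  proof -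
    have "direct_sum_mat A1 A2 *\<^sub>v (?Y (Suc n) @\<^sub>v ?Z (Suc n)) = direct_sum_mat B1 B2 *\<^sub>v (?Y n @\<^sub>v ?Z n)"
      using X by (simp add: split trajectory_def)
    then have "A1 *\<^sub>v ?Y (Suc n) @\<^sub>v A2 *\<^sub>v ?Z (Suc n) = B1 *\<^sub>v ?Y n @\<^sub>v B2 *\<^sub>v ?Z n"
      by (simp add: B)
    then show ?thesis
      by (subst (asm) append_vec_eq[of _ "dim_row A1"]) (auto simp: B carrier_vecI)
  qed
  then show "trajectory A1 B1 ?Y" and "trajectory A2 B2 ?Z"
    by (simp_all add: trajectory_def)
qed

lemma rigid_direct_sum:
  fixes A1 A2 B1 B2 :: "'a :: semiring_1 mat"
  assumes "rigid A1 B1" and "rigid A2 B2" and dims: "same_dim A1 B1" "same_dim A2 B2"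
  shows "rigid (direct_sum_mat A1 A2) (direct_sum_mat B1 B2)"
  unfolding rigid_def
proof (intro allI impI)
  fix X n assume X: "trajectory (direct_sum_mat A1 A2) (direct_sum_mat B1 B2) X"
  have "vec_first (X n) (dim_col A1) = 0\<^sub>v (dim_col A1)" "vec_last (X n) (dim_col A2) = 0\<^sub>v (dim_col A2)"
    using trajectory_direct_sum(1,2)[OF X dims] assms(1,2) by (auto simp: rigid_def)
  with trajectory_direct_sum(3)[OF X dims, of n] show "X n = 0\<^sub>v (dim_col (direct_sum_mat A1 A2))"
    by simp
qed

lemma rigid_no_columns: "dim_col A = 0 \<Longrightarrow> rigid A B"
  unfolding rigid_def trajectory_def by (metis carrier_vecD vec_of_dim_0)

lemma rigid_diag_block_mat:
  fixes f g :: "'b \<Rightarrow> 'a :: semiring_1 mat"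
  assumes "\<And>t. t \<in> set ts \<Longrightarrow> rigid (f t) (g t)"
    and "\<And>t. t \<in> set ts \<Longrightarrow> same_dim (f t) (g t)"
  shows "rigid (diag_block_mat (map f ts)) (diag_block_mat (map g ts))"
  using assms
proof (induction ts)
  case (Cons t ts)
  then show ?case
    unfolding list.map diag_block_mat_Cons
    by (intro rigid_direct_sum same_dim_diag_block_mat) auto
qed (simp add: rigid_no_columns)

text \<open>The coordinate \<open>i\<close> at time \<open>k\<close> is the coordinate \<open>i + 1\<close> at time \<open>k + 1\<close>; following this
  diagonal for \<open>n - i\<close> steps runs past the last coordinate, where the value is zero.\<close>

lemma rigid_if_shift:
  fixes A B :: "'a :: semiring_1 mat"
  assumes A: "dim_col A = n"
    and shift: "\<And>X k i. trajectory A B X \<Longrightarrow> i < n \<Longrightarrow>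
      X k $ i = (if Suc i < n then X (Suc k) $ Suc i else 0)"
  shows "rigid A B"
  unfolding rigid_def
proof (intro allI impI)
  fix X k assume X: "trajectory A B X"
  have "X k $ i = 0" if "i < n" for i k
    using that
  proof (induction "n - i" arbitrary: i k)
    case (Suc d)
    then have "Suc i < n \<Longrightarrow> X (Suc k) $ Suc i = 0"
      by (intro Suc.hyps(1)) auto
    then show ?case
      by (simp add: shift[OF X \<open>i < n\<close>])
  qed simp
  moreover have "dim_vec (X k) = n"
    using X A by (simp add: trajectory_def)
  ultimately show "X k = 0\<^sub>v (dim_col A)"
    using A by (intro eq_vecI) auto
qed

text \<open>The recurrence is \<open>H X\<^sub>k\<^sub>+\<^sub>1 = X\<^sub>k\<close> and \<open>H\<close> shifts the coordinates.\<close>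

lemma rigid_nilpotent_jordan_block: "rigid (jordan_block n (0 :: 'a :: comm_ring_1)) (1\<^sub>m n)"
proof (rule rigid_if_shift)
  fix X :: "nat \<Rightarrow> 'a vec" and k i :: nat
  assume X: "trajectory (jordan_block n 0) (1\<^sub>m n) X" and i: "i < n"
  then have dim: "X k \<in> carrier_vec n" for k
    by (simp add: trajectory_def)
  have "X k $ i = (jordan_block n 0 *\<^sub>v X (Suc k)) $ i"
    using X dim[of k] by (simp add: trajectory_def)
  also have "\<dots> = (\<Sum>j = 0..<n. jordan_block n 0 $$ (i, j) * X (Suc k) $ j)"
    using i dim[of "Suc k"] by (simp add: scalar_prod_def)
  also have "\<dots> = (\<Sum>j = 0..<n. if j = Suc i then X (Suc k) $ j else 0)"
    by (rule sum.cong) (use i in auto)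
  finally show "X k $ i = (if Suc i < n then X (Suc k) $ Suc i else 0)"
    by simp
qed simp

text \<open>Row \<open>i + 1\<close> of the recurrence \<open>(X\<^sub>k\<^sub>+\<^sub>1, 0) = (0, X\<^sub>k)\<close> is the same shift as for the nilpotent
  Jordan block; the zero past the last coordinate comes from the last row.\<close>

lemma rigid_transposed_L_block: "rigid ((L_mat n)\<^sup>T :: 'a :: field mat) ((Lbar_mat n)\<^sup>T)"
proof (rule rigid_if_shift)
  fix X :: "nat \<Rightarrow> 'a vec" and k i :: nat
  assume X: "trajectory ((L_mat n)\<^sup>T) ((Lbar_mat n)\<^sup>T) X" and i: "i < n"
  then have dim: "X k \<in> carrier_vec n" for k
    by (simp add: trajectory_def L_mat_def)
  have "X k $ i = (\<Sum>j = 0..<n. if j = i then X k $ j else 0)"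
    using i by simp
  also have "\<dots> = (\<Sum>j = 0..<n. (Lbar_mat n)\<^sup>T $$ (Suc i, j) * X k $ j)"
    by (rule sum.cong) (use i in \<open>auto simp: Lbar_mat_def\<close>)
  also have "\<dots> = ((Lbar_mat n)\<^sup>T *\<^sub>v X k) $ Suc i"
    using i dim[of k] by (simp add: Lbar_mat_def scalar_prod_def)
  also have "\<dots> = ((L_mat n)\<^sup>T *\<^sub>v X (Suc k)) $ Suc i"
    using X by (simp add: trajectory_def)
  also have "\<dots> = (\<Sum>j = 0..<n. (L_mat n)\<^sup>T $$ (Suc i, j) * X (Suc k) $ j)"
    using i dim[of "Suc k"] by (simp add: L_mat_def scalar_prod_def)
  also have "\<dots> = (\<Sum>j = 0..<n. if j = Suc i then X (Suc k) $ j else 0)"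
    by (rule sum.cong) (use i in \<open>auto simp: L_mat_def\<close>)
  finally show "X k $ i = (if Suc i < n then X (Suc k) $ Suc i else 0)"
    by simp
qed (simp add: L_mat_def)

section \<open>The Kronecker canonical form\<close>

lemma kronecker_F_direct_sum:
  "kronecker_F ps qs es zs h g = direct_sum_mat (1\<^sub>m (sum_list (map fst ps)))
     (direct_sum_mat (diag_block_mat (map (\<lambda>n. jordan_block n 0) qs))
       (direct_sum_mat (diag_block_mat (map L_mat es))
         (direct_sum_mat (diag_block_mat (map (\<lambda>n. (L_mat n)\<^sup>T) zs)) (0\<^sub>m h g))))"
  unfolding kronecker_F_def
  by (simp add: diag_block_mat_Cons jordan_matrix_def comp_def del: diag_block_mat.simps(2) diag_block_mat_singleton)

lemma kronecker_G_direct_sum: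
  "kronecker_G ps qs es zs h g = direct_sum_mat (jordan_matrix ps)
     (direct_sum_mat (diag_block_mat (map (\<lambda>n. 1\<^sub>m n) qs))
       (direct_sum_mat (diag_block_mat (map Lbar_mat es))
         (direct_sum_mat (diag_block_mat (map (\<lambda>n. (Lbar_mat n)\<^sup>T) zs)) (0\<^sub>m h g))))"
proof -
  have "diag_block_mat (map (\<lambda>n. 1\<^sub>m n :: 'a mat) qs) = 1\<^sub>m (sum_list qs)"
    using diag_block_one_mat[of "map (\<lambda>n. 1\<^sub>m n :: 'a mat) qs"] by (simp add: comp_def)
  then show ?thesis
    unfolding kronecker_G_def
    by (simp add: diag_block_mat_Cons del: diag_block_mat.simps(2) diag_block_mat_singleton)
qed

lemma same_dim_blocks:
  "same_dim (1\<^sub>m (sum_list (map fst ps))) (jordan_matrix ps)"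
  "same_dim (jordan_block n a) (1\<^sub>m n)"
  "same_dim (L_mat n) (Lbar_mat n)"
  "same_dim ((L_mat n)\<^sup>T) ((Lbar_mat n)\<^sup>T)"
  "same_dim A A"
  by (simp_all add: same_dim_def L_mat_def Lbar_mat_def)

lemma null_chain_kronecker:
  assumes "es \<noteq> [] \<or> 0 < g"
  shows "\<exists>N x. null_chain (kronecker_F ps qs es zs h g) (kronecker_G ps qs es zs h g) N x"
proof -
  note dims = same_dim_blocks same_dim_direct_sum same_dim_diag_block_mat
  from assms show ?thesis
  proof
    assume "es \<noteq> []"
    then have "\<exists>N x. null_chain (diag_block_mat (map L_mat es)) (diag_block_mat (map Lbar_mat es) :: 'a mat) N x"
      using null_chain_L_block by (intro null_chain_diag_block_mat[of _ _ _ "hd es"]) (auto intro: dims)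
    then show ?thesis
      unfolding kronecker_F_direct_sum kronecker_G_direct_sum
      by (blast intro: null_chain_direct_sum_left null_chain_direct_sum_right dims)
  next
    assume "0 < g"
    from null_chain_zero_block[OF this] show ?thesis
      unfolding kronecker_F_direct_sum kronecker_G_direct_sum
      by (blast intro: null_chain_direct_sum_right dims)
  qed
qed

text \<open>The rigid summand collects the blocks of the infinite elementary divisors and of all row minimal
  indices; the zero ones give rows of zeros without columns.\<close>

lemma kronecker_without_column_indices:
  obtains A B where
    "kronecker_F ps qs [] zs h 0 = direct_sum_mat (1\<^sub>m (sum_list (map fst ps))) A"
    "kronecker_G ps qs [] zs h 0 = direct_sum_mat (jordan_matrix ps) B"
    "same_dim A B" "rigid A B"
proof (rule that[OF kronecker_F_direct_sum kronecker_G_direct_sum])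
qed (intro rigid_direct_sum rigid_diag_block_mat same_dim_direct_sum same_dim_diag_block_mat
    same_dim_blocks rigid_nilpotent_jordan_block rigid_transposed_L_block rigid_no_columns; simp)+

section \<open>Solutions when only the finite elementary divisors contribute\<close>

lemma first_cols_carrier:
  assumes "Q \<in> carrier_mat r m" and "p \<le> m"
  shows "first_cols p Q \<in> carrier_mat r p"
  using assms by (auto simp: first_cols_def)

lemma first_cols_mult_vec:
  fixes Q :: "'a :: semiring_1 mat"
  assumes Q: "Q \<in> carrier_mat r (p + s)" and z: "z \<in> carrier_vec p"
  shows "first_cols p Q *\<^sub>v z = Q *\<^sub>v (z @\<^sub>v 0\<^sub>v s)"
proof (rule eq_vecI)
  have C: "first_cols p Q \<in> carrier_mat r p"
    using Q by (rule first_cols_carrier) simp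
  have entry: "first_cols p Q $$ (i, j) = Q $$ (i, j)" if "i < r" "j < p" for i j
    using Q that by (auto simp: first_cols_def mat_of_cols_def)
  fix i assume "i < dim_vec (Q *\<^sub>v (z @\<^sub>v 0\<^sub>v s))"
  then have i: "i < r"
    using Q by simp
  have "(Q *\<^sub>v (z @\<^sub>v 0\<^sub>v s)) $ i = (\<Sum>j = 0..<p + s. Q $$ (i, j) * (z @\<^sub>v 0\<^sub>v s) $ j)"
    using Q z i by (simp add: scalar_prod_def)
  also have "\<dots> = (\<Sum>j = 0..<p. Q $$ (i, j) * z $ j)"
    using z by (intro sum.mono_neutral_cong_right) auto
  also have "\<dots> = (first_cols p Q *\<^sub>v z) $ i"
    using C z i by (simp add: scalar_prod_def entry)
  finally show "(first_cols p Q *\<^sub>v z) $ i = (Q *\<^sub>v (z @\<^sub>v 0\<^sub>v s)) $ i" ..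
qed (use Q in \<open>simp add: first_cols_def\<close>)

lemma invertible_matE:
  assumes "invertible_mat A" and "A \<in> carrier_mat n n"
  obtains B where "B \<in> carrier_mat n n" "A * B = 1\<^sub>m n" "B * A = 1\<^sub>m n"
proof -
  obtain B where B: "A * B = 1\<^sub>m n" "B * A = 1\<^sub>m (dim_row B)"
    using assms by (auto simp: invertible_mat_def inverts_mat_def)
  have "dim_col B = n"
    using arg_cong[OF B(1), of dim_col] by simp
  moreover have "dim_row B = n"
    using arg_cong[OF B(2), of dim_col] assms(2) by simp
  ultimately show thesis
    using B by (intro that[of B]) auto
qed

lemma pow_mat_Suc_mult_vec:
  fixes J :: "'a :: semiring_1 mat"
  assumes J: "J \<in> carrier_mat p p" and z: "z \<in> carrier_vec p"
  shows "J ^\<^sub>m Suc n *\<^sub>v z = J *\<^sub>v (J ^\<^sub>m n *\<^sub>v z)"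
proof -
  have "J ^\<^sub>m Suc n = J * J ^\<^sub>m n"
  proof (induction n)
    case (Suc n)
    then have "J ^\<^sub>m Suc (Suc n) = (J * J ^\<^sub>m n) * J"
      by simp
    also have "\<dots> = J * (J ^\<^sub>m n * J)"
      using J by (intro assoc_mult_mat) auto
    finally show ?case
      by simp
  qed (use J in simp)
  then show ?thesis
    using J z assoc_mult_mat_vec[of J p p "J ^\<^sub>m n" p z] by simp
qed

text \<open>Here \<open>s F - G\<close> is equivalent to the direct sum of \<open>s I\<^sub>p - J\<close> and a rigid pencil; \<open>P'\<close> and
  \<open>Q'\<close> are the inverses of \<open>P\<close> and \<open>Q\<close>.\<close>

context
  fixes F G P P' Q Q' A B J :: "'a :: field mat" and r m p :: nat
  assumes F: "F \<in> carrier_mat r m" and G: "G \<in> carrier_mat r m"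
    and P: "P \<in> carrier_mat r r" "P' \<in> carrier_mat r r" "P' * P = 1\<^sub>m r"
    and Q: "Q \<in> carrier_mat m m" "Q' \<in> carrier_mat m m" "Q' * Q = 1\<^sub>m m" "Q * Q' = 1\<^sub>m m"
    and J: "J \<in> carrier_mat p p"
    and PFQ: "P * F * Q = direct_sum_mat (1\<^sub>m p) A"
    and PGQ: "P * G * Q = direct_sum_mat J B"
    and dims: "same_dim A B" and rigid: "rigid A B"
begin

private lemma m_eq: "m = p + dim_col A"
  using arg_cong[OF PFQ, of dim_col] Q(1) by simp

private lemma Qp: "first_cols p Q \<in> carrier_mat m p"
  using Q(1) m_eq by (intro first_cols_carrier) auto

private lemma Qp_mult_vec: "z \<in> carrier_vec p \<Longrightarrow> first_cols p Q *\<^sub>v z = Q *\<^sub>v (z @\<^sub>v 0\<^sub>v (dim_col A))"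
  using Q(1) m_eq by (intro first_cols_mult_vec) auto

lemma first_cols_inj:
  assumes "y \<in> carrier_vec p" "z \<in> carrier_vec p" "first_cols p Q *\<^sub>v y = first_cols p Q *\<^sub>v z"
  shows "y = z"
proof -
  have carr: "u @\<^sub>v 0\<^sub>v (dim_col A) \<in> carrier_vec m" if "u \<in> carrier_vec p" for u :: "'a vec"
    using that m_eq by simp
  have "y @\<^sub>v 0\<^sub>v (dim_col A) = z @\<^sub>v 0\<^sub>v (dim_col A)"
    using assms mult_mat_vec_left_inverse[OF Q(1-3) carr] by (metis Qp_mult_vec)
  then show ?thesis
    using append_vec_eq[OF assms(1,2)] by simp
qed

private lemma power_solution_mult_vec:
  assumes z: "z \<in> carrier_vec p"
  shows "(first_cols p Q * J ^\<^sub>m n) *\<^sub>v z = first_cols p Q *\<^sub>v (J ^\<^sub>m n *\<^sub>v z)"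
    and "J ^\<^sub>m n *\<^sub>v z \<in> carrier_vec p"
  using assoc_mult_mat_vec[OF Qp pow_carrier_mat[OF J] z]
    mult_mat_vec_carrier[OF pow_carrier_mat[OF J] z] by auto

text \<open>In the coordinates \<open>X = Q' Y\<close> the rigid summand vanishes, which leaves \<open>Z\<^sub>n\<^sub>+\<^sub>1 = J Z\<^sub>n\<close> for the
  first \<open>p\<close> coordinates.\<close>

lemma solution_form:
  assumes Y: "Y \<in> solutions F G k0 Y0"
  obtains z where "z \<in> carrier_vec p" "Y0 = first_cols p Q *\<^sub>v z"
    "\<And>k. k0 \<le> k \<Longrightarrow> Y k = (first_cols p Q * J ^\<^sub>m nat (k - k0)) *\<^sub>v z"
proof -
  have Y_carr: "Y k \<in> carrier_vec m" if "k0 \<le> k" for k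
    using Y F that by (auto simp: solutions_def)
  have Y_step: "F *\<^sub>v Y (k + 1) = G *\<^sub>v Y k" if "k0 \<le> k" for k
    using Y that by (simp add: solutions_def)
  define X where "X n = Q' *\<^sub>v Y (k0 + int n)" for n
  have X_carr: "X n \<in> carrier_vec m" for n
    using Q(2) Y_carr[of "k0 + int n"] by (simp add: X_def)
  have QX: "Q *\<^sub>v X n = Y (k0 + int n)" for n
    unfolding X_def using Q Y_carr by (intro mult_mat_vec_left_inverse) auto
  have "(P * F * Q) *\<^sub>v X (Suc n) = (P * G * Q) *\<^sub>v X n" for n
    using Y_step[of "k0 + int n"]
    by (simp add: equivalent_pencil_mult_vec[OF _ P(1) Q(1) X_carr] F G QX add.commute add.left_commute)
  then have traj: "trajectory (direct_sum_mat (1\<^sub>m p) A) (direct_sum_mat J B) X"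
    using X_carr m_eq by (simp add: trajectory_def PFQ PGQ)
  have dim1: "same_dim (1\<^sub>m p) J"
    using J by (simp add: same_dim_def)
  define Z where "Z n = vec_first (X n) p" for n
  have Z_carr: "Z n \<in> carrier_vec p" for n
    by (simp add: Z_def)
  have Z_step: "Z (Suc n) = J *\<^sub>v Z n" for n
    using trajectory_direct_sum(1)[OF traj dim1 dims] by (simp add: trajectory_def Z_def)
  have X_eq: "X n = Z n @\<^sub>v 0\<^sub>v (dim_col A)" for n
    using trajectory_direct_sum(2)[OF traj dim1 dims] trajectory_direct_sum(3)[OF traj dim1 dims, of n]
      rigid by (auto simp: rigid_def Z_def)
  have Z_pow: "Z n = J ^\<^sub>m n *\<^sub>v Z 0" for n
  proof (induction n)
    case 0
    show ?case
      using Z_carr[of 0] J by simp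
  next
    case (Suc n)
    then show ?case
      using pow_mat_Suc_mult_vec[OF J Z_carr[of 0]] by (simp add: Z_step)
  qed
  have Y_eq: "Y (k0 + int n) = (first_cols p Q * J ^\<^sub>m n) *\<^sub>v Z 0" for n
    using power_solution_mult_vec(1)[OF Z_carr, of n 0] Qp_mult_vec[OF Z_carr, of n]
    by (simp add: QX[symmetric] X_eq Z_pow[symmetric])
  show thesis
  proof (rule that[of "Z 0"])
    show "Y0 = first_cols p Q *\<^sub>v Z 0"
      using Y Qp_mult_vec[OF Z_carr, of 0] QX[of 0] by (simp add: solutions_def X_eq)
    show "Y k = (first_cols p Q * J ^\<^sub>m nat (k - k0)) *\<^sub>v Z 0" if "k0 \<le> k" for k
      using Y_eq[of "nat (k - k0)"] that by simp
  qed (rule Z_carr)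
qed

text \<open>Conversely, \<open>F Q\<^sub>p J = G Q\<^sub>p\<close>, since both sides agree after multiplication by \<open>P\<close> from the left.\<close>

lemma power_solution:
  assumes z: "z \<in> carrier_vec p"
  shows "(\<lambda>k \<in> {k0..}. (first_cols p Q * J ^\<^sub>m nat (k - k0)) *\<^sub>v z)
    \<in> solutions F G k0 (first_cols p Q *\<^sub>v z)"
proof -
  have step: "F *\<^sub>v (first_cols p Q *\<^sub>v (J *\<^sub>v u)) = G *\<^sub>v (first_cols p Q *\<^sub>v u)"
    if u: "u \<in> carrier_vec p" for u
  proof -
    let ?e = "\<lambda>u. u @\<^sub>v 0\<^sub>v (dim_col A)"
    have Ju: "J *\<^sub>v u \<in> carrier_vec p"
      using J u by simp
    have carr: "?e u \<in> carrier_vec m" "?e (J *\<^sub>v u) \<in> carrier_vec m"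
      using u Ju m_eq by auto
    have AB: "dim_col B = dim_col A" "dim_row B = dim_row A"
      using dims by (auto simp: same_dim_def)
    have "B *\<^sub>v 0\<^sub>v (dim_col A) = 0\<^sub>v (dim_row A)"
      using mult_mat_zero_vec[of B] by (simp only: AB)
    then have "(P * F * Q) *\<^sub>v ?e (J *\<^sub>v u) = (P * G * Q) *\<^sub>v ?e u"
      using u Ju J by (simp add: PFQ PGQ AB)
    then have "P' *\<^sub>v (P *\<^sub>v (F *\<^sub>v (Q *\<^sub>v ?e (J *\<^sub>v u)))) = P' *\<^sub>v (P *\<^sub>v (G *\<^sub>v (Q *\<^sub>v ?e u)))"
      by (simp only: equivalent_pencil_mult_vec[OF F P(1) Q(1) carr(2)]
          equivalent_pencil_mult_vec[OF G P(1) Q(1) carr(1)])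
    moreover have "F *\<^sub>v (Q *\<^sub>v ?e (J *\<^sub>v u)) \<in> carrier_vec r" "G *\<^sub>v (Q *\<^sub>v ?e u) \<in> carrier_vec r"
      using F G Q(1) carr by auto
    ultimately show ?thesis
      by (simp only: mult_mat_vec_left_inverse[OF P] Qp_mult_vec u Ju)
  qed
  show ?thesis
    unfolding solutions_def
  proof (intro CollectI conjI allI impI)
    show "(\<lambda>k \<in> {k0..}. (first_cols p Q * J ^\<^sub>m nat (k - k0)) *\<^sub>v z) \<in> {k0..} \<rightarrow>\<^sub>E carrier_vec (dim_col F)"
      using F power_solution_mult_vec[OF z] mult_mat_vec_carrier[OF Qp]
      by (auto simp del: restrict_PiE_iff)
    show "(\<lambda>k \<in> {k0..}. (first_cols p Q * J ^\<^sub>m nat (k - k0)) *\<^sub>v z) k0 = first_cols p Q *\<^sub>v z"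
      using Qp J by simp
    fix k assume k: "k0 \<le> k"
    then have "nat (k + 1 - k0) = Suc (nat (k - k0))"
      by simp
    then show "F *\<^sub>v (\<lambda>k \<in> {k0..}. (first_cols p Q * J ^\<^sub>m nat (k - k0)) *\<^sub>v z) (k + 1) =
        G *\<^sub>v (\<lambda>k \<in> {k0..}. (first_cols p Q * J ^\<^sub>m nat (k - k0)) *\<^sub>v z) k"
      using k step power_solution_mult_vec[OF z] pow_mat_Suc_mult_vec[OF J z]
      by (simp del: pow_mat.simps)
  qed
qed

end

lemma colspan_eq:
  assumes "A \<in> carrier_mat n k"
  shows "colspan A = {A *\<^sub>v z | z. z \<in> carrier_vec k}"
proof -
  have "colspan A = {y \<in> carrier_vec n. \<exists>z \<in> carrier_vec k. A *\<^sub>v z = y}"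
    using vec_space.col_space_eq[of A n k] assms unfolding colspan_def by simp
  then show ?thesis
    using assms by auto
qed
section \<open>Uniqueness of solutions of a singular system\<close>

theorem theorem3p1:
  fixes F G P Q Qp Jp :: "'a :: field mat"
    and r m p h g :: nat
    and ps :: "(nat \<times> 'a) list"
    and qs es zs :: "nat list"
    and k0 :: int
    and Y0 :: "'a vec"
  assumes "F \<in> carrier_mat r m" and "G \<in> carrier_mat r m"
    and "singular_pencil F G"
    and "P \<in> carrier_mat r r" and "invertible_mat P"
    and "Q \<in> carrier_mat m m" and "invertible_mat Q"
    and "kronecker_data ps qs es zs"
    and "P * F * Q = kronecker_F ps qs es zs h g"
    and "P * G * Q = kronecker_G ps qs es zs h g"
    and "p = sum_list (map fst ps)"
    and "Qp = first_cols p Q"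
    and "Jp = jordan_matrix ps"
    and "Y0 \<in> carrier_vec m"
  shows "((\<exists>!Y. Y \<in> solutions F G k0 Y0) \<longleftrightarrow>
            right_null_dim F G = 0 \<and> Y0 \<in> colspan Qp) \<and>
         (right_null_dim F G = 0 \<and> Y0 \<in> colspan Qp \<longrightarrow>
            (\<exists>!Z. Z \<in> carrier_vec p \<and> Y0 = Qp *\<^sub>v Z) \<and>
            (\<forall>Z \<in> carrier_vec p. Y0 = Qp *\<^sub>v Z \<longrightarrow>
               (\<forall>Y \<in> solutions F G k0 Y0. \<forall>k \<ge> k0.
                  Y k = (Qp * Jp ^\<^sub>m nat (k - k0)) *\<^sub>v Z))) \<and>
         (\<not> (right_null_dim F G = 0 \<and> Y0 \<in> colspan Qp) \<longrightarrow>
            solutions F G k0 Y0 \<noteq> {} \<longrightarrow> infinite (solutions F G k0 Y0))"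
proof -
  note F = assms(1) and G = assms(2) and P = assms(4) and Q = assms(6)
  obtain P' where P': "P' \<in> carrier_mat r r" "P' * P = 1\<^sub>m r"
    using invertible_matE[OF assms(5) P] by metis
  obtain Q' where Q': "Q' \<in> carrier_mat m m" "Q' * Q = 1\<^sub>m m" "Q * Q' = 1\<^sub>m m"
    using invertible_matE[OF assms(7) Q] by metis
  have Jp: "Jp \<in> carrier_mat p p"
    by (simp add: assms(11,13))
  show ?thesis
  proof (cases "right_null_dim F G = 0")
    case False
    then obtain N x where "null_chain F G N x"
      by (auto simp: right_null_dim_eq_0_iff[OF F G])
    then have inf: "infinite (solutions F G k0 Y0)" if "Y \<in> solutions F G k0 Y0" for Y
      using infinite_solutions_if_null_chain[OF F G] that by blast
    have "\<not> (\<exists>!Y. Y \<in> solutions F G k0 Y0)"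
    proof
      assume unique: "\<exists>!Y. Y \<in> solutions F G k0 Y0"
      then obtain Y where Y: "Y \<in> solutions F G k0 Y0"
        by blast
      then have "solutions F G k0 Y0 = {Y}"
        using unique by blast
      with inf[OF Y] show False
        by simp
    qed
    with False inf show ?thesis
      by blast
  next
    case True
    have "es = [] \<and> g = 0"
    proof (rule ccontr)
      assume "\<not> (es = [] \<and> g = 0)"
      then have "es \<noteq> [] \<or> 0 < g"
        by auto
      then obtain N x where "null_chain (P * F * Q) (P * G * Q) N x"
        unfolding assms(9,10) using null_chain_kronecker by blast
      from null_chain_equivalent_pencil[OF F G P P' Q Q'(1,2) this] True show False
        by (auto simp: right_null_dim_eq_0_iff[OF F G])
    qed
    then have no_indices: "es = []" "g = 0"
      by auto
    obtain A B where AB: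
      "kronecker_F ps qs [] zs h 0 = direct_sum_mat (1\<^sub>m (sum_list (map fst ps))) A"
      "kronecker_G ps qs [] zs h 0 = direct_sum_mat (jordan_matrix ps) B"
      "same_dim A B" "rigid A B"
      by (rule kronecker_without_column_indices)
    have PFQ: "P * F * Q = direct_sum_mat (1\<^sub>m p) A" and PGQ: "P * G * Q = direct_sum_mat Jp B"
      by (simp_all only: assms(9,10,11,13) no_indices AB(1,2))
    note solved = F G P P' Q Q' Jp PFQ PGQ AB(3,4)
    have "p \<le> m"
      using arg_cong[OF PFQ, of dim_col] Q by simp
    then have colspan: "colspan Qp = {Qp *\<^sub>v z | z. z \<in> carrier_vec p}"
      unfolding assms(12) by (rule colspan_eq[OF first_cols_carrier[OF Q]])
    have inj: "y = z" if "y \<in> carrier_vec p" "z \<in> carrier_vec p" "Qp *\<^sub>v y = Qp *\<^sub>v z" for y z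
      using first_cols_inj[OF solved that(1,2)] that(3) by (simp add: assms(12))
    have formula: "Y k = (Qp * Jp ^\<^sub>m nat (k - k0)) *\<^sub>v Z"
      if Y: "Y \<in> solutions F G k0 Y0" and Z: "Z \<in> carrier_vec p" "Y0 = Qp *\<^sub>v Z" and k: "k0 \<le> k"
      for Y Z k
    proof -
      obtain z where z: "z \<in> carrier_vec p" "Y0 = Qp *\<^sub>v z"
        "\<And>k. k0 \<le> k \<Longrightarrow> Y k = (Qp * Jp ^\<^sub>m nat (k - k0)) *\<^sub>v z"
        by (rule solution_form[OF solved Y, folded assms(12)]) (rule that)
      have "z = Z"
        using z(2) Z(2) by (intro inj[OF z(1) Z(1)]) simp
      with z(3)[OF k] show ?thesis
        by simp
    qed
    have in_colspan: "Y0 \<in> colspan Qp" if Y: "Y \<in> solutions F G k0 Y0" for Y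
    proof -
      obtain z where "z \<in> carrier_vec p" "Y0 = Qp *\<^sub>v z"
        by (rule solution_form[OF solved Y, folded assms(12)]) (rule that)
      then show ?thesis
        by (auto simp: colspan)
    qed
    have unique: "\<exists>!Y. Y \<in> solutions F G k0 Y0" if span: "Y0 \<in> colspan Qp"
    proof -
      obtain Z where Z: "Z \<in> carrier_vec p" "Y0 = Qp *\<^sub>v Z"
        using span unfolding colspan by blast
      show ?thesis
      proof (rule ex_ex1I)
        show "\<exists>Y. Y \<in> solutions F G k0 Y0"
          unfolding Z(2) by (rule exI) (rule power_solution[OF solved Z(1), folded assms(12)])
        fix Y Y' assume Y: "Y \<in> solutions F G k0 Y0" and Y': "Y' \<in> solutions F G k0 Y0"
        show "Y = Y'"
        proof (rule extensionalityI[of _ "{k0..}"])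
          show "Y k = Y' k" if "k \<in> {k0..}" for k
            using that by (simp only: formula[OF Y Z] formula[OF Y' Z] atLeast_iff)
        qed (use Y Y' in \<open>auto simp: solutions_def PiE_def\<close>)
      qed
    qed
    have "\<exists>!Z. Z \<in> carrier_vec p \<and> Y0 = Qp *\<^sub>v Z" if span: "Y0 \<in> colspan Qp"
    proof -
      obtain Z where Z: "Z \<in> carrier_vec p" "Y0 = Qp *\<^sub>v Z"
        using span unfolding colspan by blast
      show ?thesis
      proof (rule ex1I[of _ Z])
        show "Z \<in> carrier_vec p \<and> Y0 = Qp *\<^sub>v Z"
          using Z by (rule conjI)
        fix y assume y: "y \<in> carrier_vec p \<and> Y0 = Qp *\<^sub>v y"
        then have "Qp *\<^sub>v y = Qp *\<^sub>v Z"
          using Z(2) by (elim conjE) (rule trans[OF sym])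
        with y Z(1) show "y = Z"
          by (blast intro: inj)
      qed
    qed
    then show ?thesis
    proof (intro conjI impI ballI allI)
      show "(\<exists>!Y. Y \<in> solutions F G k0 Y0) \<longleftrightarrow> right_null_dim F G = 0 \<and> Y0 \<in> colspan Qp"
        using True unique in_colspan by auto
    next
      fix Z Y k
      assume "Z \<in> carrier_vec p" "Y0 = Qp *\<^sub>v Z" "Y \<in> solutions F G k0 Y0" "k0 \<le> k"
      then show "Y k = (Qp * Jp ^\<^sub>m nat (k - k0)) *\<^sub>v Z"
        by (intro formula)
    next
      assume "\<not> (right_null_dim F G = 0 \<and> Y0 \<in> colspan Qp)" "solutions F G k0 Y0 \<noteq> {}"
      then show "infinite (solutions F G k0 Y0)"
        using True in_colspan by auto
    qed simp
  qed
qed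

end
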